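(* Let $\mathcal{T}'\in\mathbb{K}^{I_1\times I_2\times I_3}$ have $\mathbb{K}$-rank $R$ and multilinear rank $(R,R,K)$, and let $\mathcal{T}\in\mathbb{K}^{R\times R\times K}$ be an orthogonal compression of $\mathcal{T}'$. Let $\mathbf{U}\in\mathbb{K}^{K\times K}$ be unitary and $\mathcal{S}=\mathcal{T}\cdot_3\mathbf{U}$, with frontal slices $\mathbf{S}_k=\mathcal{S}(:,:,k)$. For each $i=1,\dots,\lfloor K/2\rfloor$ let $\epsilon_i\geq 0$ be such that every matrix pencil (i.e. tensor in $\mathbb{K}^{R\times R\times 2}$) in the open Frobenius-norm ball of radius $\epsilon_i$ around the pencil $(\mathbf{S}_{2i-1},\mathbf{S}_{2i})$ is simple, and set $\epsilon=\|(\epsilon_1,\dots,\epsilon_{\lfloor K/2\rfloor})\|_2$. Then every tensor in the open Frobenius ball of radius $\epsilon/2$ centered at $\mathcal{T}$ has a best $\mathbb{K}$-rank $R$ approximation, every tensor of $\mathbb{K}$-rank $R$ in the open Frobenius ball of radius $\epsilon$ centered at $\mathcal{T}$ has a unique CPD, and the set of tensors in the open ball of radius $\epsilon/2$ centered at $\mathcal{T}$ whose best $\mathbb{K}$-rank $R$ approximation is not unique has Lebesgue measure zero.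
   Context: $\mathbb{K}$ denotes $\mathbb{R}$ or $\mathbb{C}$. The $\mathbb{K}$-rank of a tensor is the least number of rank one tensors $\mathbf{a}\otimes\mathbf{b}\otimes\mathbf{c}$ (nonzero $\mathbb{K}$-vectors) summing to it; such a minimal sum is a CPD; a CPD is unique if any other CPD differs only by a common column permutation and column scalings of the factor matrices. A best $\mathbb{K}$-rank $R$ approximation of $\mathcal{M}$ is a tensor of $\mathbb{K}$-rank at most $R$ minimizing Frobenius distance to $\mathcal{M}$. Multilinear rank $(R_1,R_2,R_3)$: $R_i$ is the dimension of the span of the mode-$i$ fibers. $\cdot_i\mathbf{U}$ denotes applying $\mathbf{U}$ to every mode-$i$ fiber. An orthogonal compression of $\mathcal{T}'$ is $\mathcal{T}'\cdot_1\mathbf{V}_1^{\mathrm{H}}\cdot_2\mathbf{V}_2^{\mathrm{H}}\cdot_3\mathbf{V}_3^{\mathrm{H}}$ where $\mathbf{V}_i$ has orthonormal columns forming a basis of the span of the mode-$i$ fibers of $\mathcal{T}'$. A tensor $\mathcal{W}\in\mathbb{K}^{R\times R\times L}$ with slices $\mathbf{W}_k$ is slice mix invertible if some linear combination of the $\mathbf{W}_k$ is invertible, and simple if it is slice mix invertible and $\det(\sum_k\gamma_k\mathbf{W}_k)$ factors as a product of $R$ pairwise non-proportional linear forms in $\gamma_1,\dots,\gamma_L$. *)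

theory Defs
  imports "HOL-Analysis.Analysis"
begin

text \<open>The scalar field K is a type variable 'a of class real_normed_field and
  euclidean_space (instances: real, complex).  Third-order tensors in K^(I1 x I2 x I3)
  are elements of 'a^'i3^'i2^'i1, entry (i,j,k) is T $ i $ j $ k.  The norm on this
  type is the Frobenius norm.\<close>

type_synonym ('a, 'i, 'j, 'k) tensor = "'a^'k^'j^'i"

text \<open>Complex conjugation, uniformly for K = R (identity) and K = C (cnj):
  conj x = |x|^2 / x.\<close>
definition kconj :: "'a::real_normed_field \<Rightarrow> 'a" where
  "kconj x = of_real ((norm x)^2) / x"

definition outer3 :: "'a::field^'i \<Rightarrow> 'a^'j \<Rightarrow> 'a^'k \<Rightarrow> ('a,'i,'j,'k) tensor" where
  "outer3 a b c = (\<chi> i j k. a$i * b$j * c$k)"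

definition is_decomp :: "('a::field,'i::finite,'j::finite,'k::finite) tensor \<Rightarrow> nat \<Rightarrow>
   (nat \<Rightarrow> 'a^'i) \<Rightarrow> (nat \<Rightarrow> 'a^'j) \<Rightarrow> (nat \<Rightarrow> 'a^'k) \<Rightarrow> bool" where
  "is_decomp T r A B C \<longleftrightarrow> (\<forall>p<r. A p \<noteq> 0 \<and> B p \<noteq> 0 \<and> C p \<noteq> 0) \<and>
     T = (\<Sum>p<r. outer3 (A p) (B p) (C p))"

definition krank :: "('a::field,'i::finite,'j::finite,'k::finite) tensor \<Rightarrow> nat" where
  "krank T = (LEAST r. \<exists>A B C. is_decomp T r A B C)"

definition is_CPD where
  "is_CPD T A B C \<longleftrightarrow> is_decomp T (krank T) A B C"

definition unique_CPD :: "('a::field,'i::finite,'j::finite,'k::finite) tensor \<Rightarrow> bool" where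
  "unique_CPD T \<longleftrightarrow> (\<exists>A B C. is_CPD T A B C) \<and>
     (\<forall>A B C A' B' C'. is_CPD T A B C \<longrightarrow> is_CPD T A' B' C' \<longrightarrow>
        (\<exists>\<sigma> \<alpha> \<beta> \<gamma>. \<sigma> permutes {..<krank T} \<and>
           (\<forall>p<krank T. A' p = \<alpha> p *s A (\<sigma> p) \<and> B' p = \<beta> p *s B (\<sigma> p)
                        \<and> C' p = \<gamma> p *s C (\<sigma> p))))"

definition best_rank_approx ::
  "nat \<Rightarrow> ('a::{real_normed_field,euclidean_space},'i::finite,'j::finite,'k::finite) tensor \<Rightarrow> ('a,'i,'j,'k) tensor \<Rightarrow> bool" where
  "best_rank_approx R M X \<longleftrightarrow> krank X \<le> R \<and> (\<forall>Y. krank Y \<le> R \<longrightarrow> dist M X \<le> dist M Y)"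

definition fibers1 :: "('a,'i::finite,'j::finite,'k::finite) tensor \<Rightarrow> ('a^'i) set" where
  "fibers1 T = {(\<chi> i. T$i$j$k) | j k. True}"
definition fibers2 :: "('a,'i::finite,'j::finite,'k::finite) tensor \<Rightarrow> ('a^'j) set" where
  "fibers2 T = {(\<chi> j. T$i$j$k) | i k. True}"
definition fibers3 :: "('a,'i::finite,'j::finite,'k::finite) tensor \<Rightarrow> ('a^'k) set" where
  "fibers3 T = {(\<chi> k. T$i$j$k) | i j. True}"

definition mlrank :: "('a::field,'i::finite,'j::finite,'k::finite) tensor \<Rightarrow> nat \<times> nat \<times> nat" where
  "mlrank T = (vec.dim (fibers1 T), vec.dim (fibers2 T), vec.dim (fibers3 T))"

definition orthonormal_cols :: "'a::real_normed_field^'m::finite^'n::finite \<Rightarrow> bool" where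
  "orthonormal_cols V \<longleftrightarrow>
     (\<forall>a b. (\<Sum>i\<in>UNIV. kconj (V$i$a) * V$i$b) = (if a = b then 1 else 0))"

definition unitary :: "'a::real_normed_field^'n::finite^'n \<Rightarrow> bool" where
  "unitary U \<longleftrightarrow> orthonormal_cols U"

definition col_set :: "'a^'m::finite^'n::finite \<Rightarrow> ('a^'n) set" where
  "col_set V = {column a V | a. True}"

definition orth_compression ::
  "('a::{real_normed_field},'i1::finite,'i2::finite,'i3::finite) tensor \<Rightarrow>
   'a^'r1::finite^'i1 \<Rightarrow> 'a^'r2::finite^'i2 \<Rightarrow> 'a^'r3::finite^'i3 \<Rightarrow> ('a,'r1,'r2,'r3) tensor \<Rightarrow> bool" where
  "orth_compression T' V1 V2 V3 T \<longleftrightarrow>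
     orthonormal_cols V1 \<and> orthonormal_cols V2 \<and> orthonormal_cols V3 \<and>
     vec.span (col_set V1) = vec.span (fibers1 T') \<and>
     vec.span (col_set V2) = vec.span (fibers2 T') \<and>
     vec.span (col_set V3) = vec.span (fibers3 T') \<and>
     T = (\<chi> a b c. \<Sum>i\<in>UNIV. \<Sum>j\<in>UNIV. \<Sum>k\<in>UNIV.
            kconj (V1$i$a) * kconj (V2$j$b) * kconj (V3$k$c) * T'$i$j$k)"

definition mode3_mult :: "('a::semiring_1,'i::finite,'j::finite,'k::finite) tensor \<Rightarrow> 'a^'k^'l::finite \<Rightarrow> ('a,'i,'j,'l) tensor" where
  "mode3_mult T U = (\<chi> a b c. \<Sum>k\<in>UNIV. U$c$k * T$a$b$k)"

definition slice :: "('a,'i::finite,'j::finite,'k::finite) tensor \<Rightarrow> 'k \<Rightarrow> 'a^'j^'i" where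
  "slice W k = (\<chi> a b. W$a$b$k)"

definition slice_mix :: "('a::semiring_1,'r::finite,'r,'l::finite) tensor \<Rightarrow> 'a^'l \<Rightarrow> 'a^'r^'r" where
  "slice_mix W \<gamma> = (\<chi> a b. \<Sum>k\<in>UNIV. \<gamma>$k * slice W k $ a $ b)"

definition slice_mix_invertible :: "('a::field,'r::finite,'r,'l::finite) tensor \<Rightarrow> bool" where
  "slice_mix_invertible W \<longleftrightarrow> (\<exists>\<gamma>::'a^'l. invertible (slice_mix W \<gamma>))"

definition proportional :: "'a::field^'l::finite \<Rightarrow> 'a^'l \<Rightarrow> bool" where
  "proportional u v \<longleftrightarrow> (\<exists>c. u = c *s v) \<or> (\<exists>c. v = c *s u)"

definition simple_tensor :: "('a::field,'r::finite,'r,'l::finite) tensor \<Rightarrow> bool" where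
  "simple_tensor W \<longleftrightarrow> slice_mix_invertible W \<and>
     (\<exists>f :: nat \<Rightarrow> 'a^'l.
        (\<forall>p<CARD('r). \<forall>q<CARD('r). p \<noteq> q \<longrightarrow> \<not> proportional (f p) (f q)) \<and>
        (\<forall>\<gamma>::'a^'l. det (slice_mix W \<gamma>) =
                     (\<Prod>p<CARD('r). \<Sum>k\<in>UNIV. (f p)$k * \<gamma>$k)))"

text \<open>The pencil (S_{2i-1}, S_{2i}) in K^(R x R x 2), with mode-3 indices enumerated by e.\<close>
definition pencil :: "('a,'r::finite,'r,'k::finite) tensor \<Rightarrow> (nat \<Rightarrow> 'k) \<Rightarrow> nat \<Rightarrow> ('a,'r,'r,2) tensor" where
  "pencil S e i = (\<chi> a b (l::2). S$a$b$(e (if l = 1 then 2*i - 1 else 2*i)))"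

end

theory Submission
  imports Defs
begin

text \<open>
  The unitary change of slices is an isometry, and the squared norms of the pencils add up to at most
  the squared norm of the tensor.  Hence every tensor \<open>X\<close> in the ball of radius \<open>\<epsilon>\<close> around
  \<open>T\<close> has at least one simple pencil: an invertible mix \<open>M\<^sub>0\<close> of its slices and another mix
  \<open>M\<^sub>1\<close> such that \<open>M\<^sub>0\<^bsup>-1\<^esup>M\<^sub>1\<close> has \<open>R\<close> distinct eigenvalues, with
  eigenvectors \<open>v\<^sub>q\<close>.

  Uniqueness: in any decomposition of \<open>X\<close> into \<open>R\<close> rank one terms, the second factors are dual to
  the \<open>v\<^sub>q\<close> up to order and scaling, and this determines the other factors.
  Existence: for a tensor of rank at most \<open>R\<close> with \<open>M\<^sub>0\<close> invertible, any two slice mixes satisfy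
  \<open>M M\<^sub>0\<^bsup>-1\<^esup> M' = M' M\<^sub>0\<^bsup>-1\<^esup> M\<close>.  This passes to limits, and a limit with a simple
  pencil is then diagonalised by the \<open>v\<^sub>q\<close>, so it still has rank at most \<open>R\<close>.  A nearest point to
  a tensor in the ball of radius \<open>\<epsilon>/2\<close> in the closure of the set of tensors of rank at most \<open>R\<close>
  lies in the ball of radius \<open>\<epsilon>\<close>, so it is a best approximation.
  Measure zero: by monotonicity of the nearest-point relation, the points with two nearest points in a
  closed set are covered by countably many compact sets, each of which meets every line in some
  coordinate direction at most once.
\<close>

section \<open>Conjugation and unitary changes of the third mode\<close>

text \<open>The norm is multiplicative; polarising the squared identity first in the right and then
  in the left factor gives this form.\<close>

lemma inner_mult_mult:
  fixes x y z w :: "'a::{real_normed_field,euclidean_space}"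
  shows "(x * y) \<bullet> (z * w) + (x * w) \<bullet> (z * y) = 2 * (x \<bullet> z) * (y \<bullet> w)"
proof -
  have nn: "(u * v) \<bullet> (u * v) = (u \<bullet> u) * (v \<bullet> v)" for u v :: 'a
    by (simp add: dot_square_norm norm_mult power_mult_distrib)
  have left: "(u * v) \<bullet> (u * v') = (u \<bullet> u) * (v \<bullet> v')" for u v v' :: 'a
    using nn[of u "v + v'"] nn[of u v] nn[of u v']
    by (simp add: algebra_simps inner_add_left inner_add_right inner_commute)
  show ?thesis
    using left[of "x + z" y w] left[of x y w] left[of z y w]
    by (simp add: algebra_simps inner_add_left inner_add_right inner_commute)
qed

text \<open>The abstract scalar field is a composition algebra, so its conjugation is the reflection
  fixing the reals; in particular it is additive.\<close>

lemma kconj_eq: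
  fixes x :: "'a::{real_normed_field,euclidean_space}"
  shows "kconj x = of_real (2 * (x \<bullet> 1)) - x"
proof -
  define c where "c = of_real (2 * (x \<bullet> 1)) - x"
  \<comment> \<open>Multiplication by \<open>c\<close> is adjoint to multiplication by
    \<open>x\<close>. Taking \<open>y = x\<close> identifies \<open>c * x\<close> with the real
    number that \<open>kconj\<close> divides by \<open>x\<close>.\<close>
  have adj: "w \<bullet> (c * y) = (x * w) \<bullet> y" for w y :: 'a
  proof -
    have "c * y = (2 * (x \<bullet> 1)) *\<^sub>R y - x * y"
      by (simp add: c_def scaleR_conv_of_real algebra_simps)
    then show ?thesis
      using inner_mult_mult[of x y 1 w] by (simp add: inner_diff_right inner_commute)
  qed
  have "w \<bullet> (c * x) = w \<bullet> of_real ((norm x)\<^sup>2)" for w :: 'a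
  proof -
    have "w \<bullet> (c * x) = (x * w) \<bullet> (x * 1)" by (simp add: adj)
    also have "\<dots> = (norm x)\<^sup>2 * (w \<bullet> 1)"
      using inner_mult_mult[of x w x 1]
      by (simp add: inner_commute dot_square_norm)
    finally show ?thesis by (simp add: of_real_def)
  qed
  then have "c * x = of_real ((norm x)\<^sup>2)" using vector_eq_ldot by blast
  then show ?thesis
    by (cases "x = 0") (auto simp: kconj_def c_def field_simps)
qed

lemma kconj_add: "kconj (x + y) = kconj x + kconj (y::'a::{real_normed_field,euclidean_space})"
  by (simp add: kconj_eq inner_add_left algebra_simps)

lemma kconj_sum: "kconj (sum f A) = (\<Sum>i\<in>A. kconj (f i :: 'a::{real_normed_field,euclidean_space}))"
  by (induction A rule: infinite_finite_induct) (auto simp: kconj_add kconj_def[of 0])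

lemma kconj_mult: "kconj (x * y) = kconj x * kconj y"
  by (simp add: kconj_def norm_mult power_mult_distrib)

lemma kconj_mult_self: "kconj x * x = of_real ((norm x)\<^sup>2)"
  by (cases "x = 0") (simp_all add: kconj_def)

text \<open>Writing a squared norm as \<open>kconj w * w\<close> turns the left side into a double
  sum against the Gram matrix of the columns, which is the identity. The computation runs in
  \<open>'a\<close> and descends to the reals because \<open>of_real\<close> is injective.\<close>

lemma orthonormal_cols_norm:
  fixes V :: "'a::{real_normed_field,euclidean_space}^'m::finite^'n::finite" and z :: "'m \<Rightarrow> 'a"
  assumes "orthonormal_cols V"
  shows "(\<Sum>c\<in>UNIV. (norm (\<Sum>k\<in>UNIV. V $ c $ k * z k))\<^sup>2) = (\<Sum>k\<in>UNIV. (norm (z k))\<^sup>2)"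
proof -
  have "of_real (\<Sum>c\<in>UNIV. (norm (\<Sum>k\<in>UNIV. V $ c $ k * z k))\<^sup>2)
      = (\<Sum>c\<in>UNIV. \<Sum>k\<in>UNIV. \<Sum>l\<in>UNIV. kconj (z k) * z l * (kconj (V $ c $ k) * V $ c $ l))"
    unfolding of_real_sum kconj_mult_self[symmetric] kconj_sum kconj_mult sum_product
    by (intro sum.cong refl) (simp add: mult_ac)
  also have "\<dots> = (\<Sum>k\<in>UNIV. \<Sum>l\<in>UNIV. kconj (z k) * z l * (\<Sum>c\<in>UNIV. kconj (V $ c $ k) * V $ c $ l))"
    by (subst sum.swap, rule sum.cong[OF refl], subst sum.swap) (simp add: sum_distrib_left)
  also have "\<dots> = of_real (\<Sum>k\<in>UNIV. (norm (z k))\<^sup>2)"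
  proof -
    have "(\<Sum>c\<in>UNIV. kconj (V $ c $ k) * V $ c $ l) = (if k = l then 1 else 0)" for k l
      using assms by (simp only: orthonormal_cols_def)
    then show ?thesis
      by (simp only:) (simp add: kconj_mult_self if_distrib sum.delta cong: if_cong)
  qed
  finally show ?thesis by (simp only: of_real_eq_iff)
qed

lemma norm_vec_power2: "(norm (x :: 'a::real_normed_vector^'n::finite))\<^sup>2 = (\<Sum>i\<in>UNIV. (norm (x $ i))\<^sup>2)"
  by (simp add: norm_vec_def L2_set_def sum_nonneg)

lemma norm_mode3_mult:
  fixes Z :: "('a::{real_normed_field,euclidean_space},'i::finite,'j::finite,'k::finite) tensor"
  assumes "unitary U"
  shows "norm (mode3_mult Z U) = norm Z"
proof -
  have "(norm (mode3_mult Z U))\<^sup>2 = (norm Z)\<^sup>2"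
    using assms by (simp add: norm_vec_power2 mode3_mult_def unitary_def orthonormal_cols_norm)
  then show ?thesis by (simp add: power2_eq_iff_nonneg)
qed

lemma mode3_mult_diff: "mode3_mult (X - Y) U = mode3_mult X U - mode3_mult (Y :: ('a::ring_1,'i::finite,'j::finite,'k::finite) tensor) U"
  by (simp add: mode3_mult_def vec_eq_iff right_diff_distrib sum_subtractf)

section \<open>Pencils of nearby tensors\<close>

lemma sum_pairs: "(\<Sum>i=1..n. g (2 * i - 1) + g (2 * i)) = (\<Sum>m=1..2 * n. g m)"
  for g :: "nat \<Rightarrow> 'b::comm_monoid_add"
  by (induction n) (simp_all add: add.assoc)

text \<open>Distinct pencils use disjoint pairs of slices. For odd \<open>CARD('k)\<close> the last
  slice belongs to none of them, hence only an inequality.\<close>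

lemma sum_norm_pencil_le:
  fixes Z :: "('a::real_normed_vector,'r::finite,'r,'k::finite) tensor"
  assumes "bij_betw e {1..CARD('k)} UNIV"
  shows "(\<Sum>i=1..CARD('k) div 2. (norm (pencil Z e i))\<^sup>2) \<le> (norm Z)\<^sup>2"
proof -
  have le: "(\<Sum>i=1..CARD('k) div 2. (norm (Z$a$b$e (2*i-1)))\<^sup>2 + (norm (Z$a$b$e (2*i)))\<^sup>2)
     \<le> (\<Sum>c\<in>UNIV. (norm (Z$a$b$c))\<^sup>2)" for a b
  proof -
    have "(\<Sum>i=1..CARD('k) div 2. (norm (Z$a$b$e (2*i-1)))\<^sup>2 + (norm (Z$a$b$e (2*i)))\<^sup>2)
      = (\<Sum>m=1..2 * (CARD('k) div 2). (norm (Z$a$b$e m))\<^sup>2)"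
      by (rule sum_pairs)
    also have "\<dots> \<le> (\<Sum>m=1..CARD('k). (norm (Z$a$b$e m))\<^sup>2)"
      by (rule sum_mono2) auto
    also have "\<dots> = (\<Sum>c\<in>UNIV. (norm (Z$a$b$c))\<^sup>2)"
      by (rule sum.reindex_bij_betw[OF assms])
    finally show ?thesis .
  qed
  have "(\<Sum>i=1..CARD('k) div 2. (norm (pencil Z e i))\<^sup>2)
     = (\<Sum>i=1..CARD('k) div 2. \<Sum>a\<in>UNIV. \<Sum>b\<in>UNIV. (norm (Z$a$b$e (2*i-1)))\<^sup>2 + (norm (Z$a$b$e (2*i)))\<^sup>2)"
    by (simp add: norm_vec_power2 pencil_def sum_2)
  also have "\<dots> = (\<Sum>a\<in>UNIV. \<Sum>b\<in>UNIV. \<Sum>i=1..CARD('k) div 2. (norm (Z$a$b$e (2*i-1)))\<^sup>2 + (norm (Z$a$b$e (2*i)))\<^sup>2)"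
    by (subst sum.swap, rule sum.cong[OF refl], subst sum.swap, rule refl)
  also have "\<dots> \<le> (norm Z)\<^sup>2"
    unfolding norm_vec_power2 by (intro sum_mono le)
  finally show ?thesis .
qed

text \<open>Pigeonhole: if every pencil moved by at least \<open>eps i\<close>, the squared
  displacements would add up to more than the squared distance of \<open>X\<close> from
  \<open>T\<close>.\<close>

lemma simple_pencil_in_ball:
  fixes T X :: "('a::{real_normed_field,euclidean_space},'r::finite,'r,'k::finite) tensor"
  assumes unit: "unitary U"
    and enum: "bij_betw e {1..CARD('k)} UNIV"
    and eps: "\<forall>i\<in>{1..CARD('k) div 2}. eps i \<ge> 0"
    and simple: "\<forall>i\<in>{1..CARD('k) div 2}. \<forall>P \<in> ball (pencil (mode3_mult T U) e i) (eps i). simple_tensor P"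
    and X: "X \<in> ball T (sqrt (\<Sum>i=1..CARD('k) div 2. (eps i)\<^sup>2))"
  shows "\<exists>i. simple_tensor (pencil (mode3_mult X U) e i)"
proof -
  let ?I = "{1..CARD('k) div 2}"
  have diff: "pencil (mode3_mult T U) e i - pencil (mode3_mult X U) e i = pencil (mode3_mult (T - X) U) e i" for i
    by (simp add: mode3_mult_diff pencil_def vec_eq_iff)
  have "(\<Sum>i\<in>?I. (norm (pencil (mode3_mult (T - X) U) e i))\<^sup>2) \<le> (norm (T - X))\<^sup>2"
    using sum_norm_pencil_le[OF enum, of "mode3_mult (T - X) U"] by (simp add: norm_mode3_mult[OF unit])
  also have "\<dots> < (\<Sum>i\<in>?I. (eps i)\<^sup>2)"
    using X by (simp add: dist_norm real_less_rsqrt) (metis norm_ge_zero real_sqrt_abs2 real_sqrt_less_iff abs_of_nonneg power2_eq_square)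
  finally obtain i where i: "i \<in> ?I" "(norm (pencil (mode3_mult (T - X) U) e i))\<^sup>2 < (eps i)\<^sup>2"
    by (meson leD not_le_imp_less sum_mono)
  then have "norm (pencil (mode3_mult (T - X) U) e i) < eps i"
    using eps power2_less_imp_less by blast
  then show ?thesis using simple i(1) by (intro exI[of _ i]) (simp add: dist_norm diff)
qed

section \<open>Rank and sums of rank one terms\<close>

text \<open>\<open>is_decomp\<close> demands nonzero factors, so terms with a zero factor are
  dropped and the rest renumbered; this is why \<open>r\<close> may be smaller than
  \<open>card I\<close>.\<close>

lemma is_decomp_if_sum:
  assumes "finite I" and T: "T = (\<Sum>i\<in>I. outer3 (A i) (B i) (C i))"
  shows "\<exists>r\<le>card I. \<exists>A B C. is_decomp T r A B C"
proof -
  define J where "J = {i\<in>I. A i \<noteq> 0 \<and> B i \<noteq> 0 \<and> C i \<noteq> 0}"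
  have J: "finite J" "J \<subseteq> I" using assms(1) by (auto simp: J_def)
  obtain h where h: "bij_betw h {0..<card J} J"
    using ex_bij_betw_nat_finite[OF J(1)] by blast
  have "outer3 (A i) (B i) (C i) = 0" if "i \<in> I - J" for i
    using that by (auto simp: J_def outer3_def vec_eq_iff)
  then have "T = (\<Sum>i\<in>J. outer3 (A i) (B i) (C i))"
    unfolding T using J assms(1) by (intro sum.mono_neutral_right) auto
  also have "\<dots> = (\<Sum>p<card J. outer3 (A (h p)) (B (h p)) (C (h p)))"
    using sum.reindex_bij_betw[OF h, of "\<lambda>i. outer3 (A i) (B i) (C i)"]
    by (simp add: atLeast0LessThan)
  finally have "is_decomp T (card J) (A \<circ> h) (B \<circ> h) (C \<circ> h)"
    using h by (force simp: is_decomp_def J_def bij_betw_def)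
  then show ?thesis using J assms(1) card_mono by blast
qed

text \<open>The entries times the standard unit tensors give such a sum, so the \<open>LEAST\<close>
  in \<open>krank\<close> is attained.\<close>

lemma ex_is_decomp: "\<exists>r A B C. is_decomp T r A B C"
proof -
  have "T = (\<Sum>(i,j,k)\<in>UNIV. outer3 (axis i (T$i$j$k)) (axis j 1) (axis k 1))"
  proof -
    have "(\<Sum>(i,j,k)\<in>UNIV. outer3 (axis i (T$i$j$k)) (axis j 1) (axis k 1)) $ a $ b $ c = T $ a $ b $ c" for a b c
    proof -
      have "(\<Sum>(i,j,k)\<in>UNIV. outer3 (axis i (T$i$j$k)) (axis j 1) (axis k 1)) $ a $ b $ c
        = (\<Sum>i\<in>UNIV. if i = (a,b,c) then T $ a $ b $ c else 0)"
        unfolding sum_component by (intro sum.cong) (auto simp: outer3_def axis_def split: if_splits)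
      then show ?thesis by simp
    qed
    then show ?thesis by (simp add: vec_eq_iff)
  qed
  then show ?thesis
    using is_decomp_if_sum[of UNIV T "\<lambda>(i,j,k). axis i (T$i$j$k)" "\<lambda>(i,j,k). axis j 1" "\<lambda>(i,j,k). axis k 1"]
    by (auto simp: case_prod_beta)
qed

lemma ex_is_CPD: "\<exists>A B C. is_CPD T A B C"
  unfolding is_CPD_def krank_def using ex_is_decomp[of T] by (rule LeastI_ex)

lemma krank_le_if_sum:
  assumes "finite I" "T = (\<Sum>i\<in>I. outer3 (A i) (B i) (C i))"
  shows "krank T \<le> card I"
proof -
  obtain r where r: "r \<le> card I" "\<exists>A B C. is_decomp T r A B C"
    using is_decomp_if_sum[OF assms] by blast
  have "krank T \<le> r" unfolding krank_def by (rule Least_le) (rule r(2))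
  with r(1) show ?thesis by simp
qed

text \<open>Padding with zero terms up to \<open>CARD('r)\<close> lets the factors be indexed by the
  type \<open>'r\<close> itself, so that later they form square matrices.\<close>

lemma sum_if_krank_le:
  fixes T :: "('a::field,'i::finite,'j::finite,'k::finite) tensor"
  assumes "krank T \<le> CARD('r::finite)"
  shows "\<exists>A B C. T = (\<Sum>p\<in>(UNIV::'r set). outer3 (A p) (B p) (C p))"
proof -
  obtain A B C where T: "T = (\<Sum>p<krank T. outer3 (A p) (B p) (C p))"
    using ex_is_CPD[of T] by (auto simp: is_CPD_def is_decomp_def)
  obtain h where h: "bij_betw h (UNIV::'r set) {0..<CARD('r)}"
    using ex_bij_betw_finite_nat[of "UNIV::'r set"] by auto
  define A' where "A' p = (if p < krank T then A p else 0)" for p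
  have "T = (\<Sum>p<krank T. outer3 (A' p) (B p) (C p))"
    by (subst T) (simp add: A'_def)
  also have "\<dots> = (\<Sum>p\<in>{0..<CARD('r)}. outer3 (A' p) (B p) (C p))"
    using assms by (intro sum.mono_neutral_left) (auto simp: A'_def outer3_def vec_eq_iff)
  also have "\<dots> = (\<Sum>p\<in>(UNIV::'r set). outer3 (A' (h p)) (B (h p)) (C (h p)))"
    using sum.reindex_bij_betw[OF h, of "\<lambda>p. outer3 (A' p) (B p) (C p)"] by simp
  finally show ?thesis
    by (intro exI[of _ "\<lambda>p. A' (h p)"] exI[of _ "\<lambda>p. B (h p)"] exI[of _ "\<lambda>p. C (h p)"])
qed

text \<open>Linear maps in the three modes send a rank one term to a rank one term or to zero.
  Applied to the compression, this bounds the rank of \<open>T\<close>.\<close>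

lemma mode_products_krank_le:
  fixes T' :: "('a::field,'i1::finite,'i2::finite,'i3::finite) tensor"
    and T :: "('a,'j1::finite,'j2::finite,'j3::finite) tensor"
  assumes T: "T = (\<chi> a b c. \<Sum>i\<in>UNIV. \<Sum>j\<in>UNIV. \<Sum>k\<in>UNIV. F a i * G b j * H c k * T'$i$j$k)"
  shows "krank T \<le> krank T'"
proof -
  obtain A B C where T': "T' = (\<Sum>p<krank T'. outer3 (A p) (B p) (C p))"
    using ex_is_CPD[of T'] by (auto simp: is_CPD_def is_decomp_def)
  have "T $ a $ b $ c = (\<Sum>p<krank T'. (\<Sum>i\<in>UNIV. F a i * A p $ i) * (\<Sum>j\<in>UNIV. G b j * B p $ j)
       * (\<Sum>k\<in>UNIV. H c k * C p $ k))" (is "_ = ?r") for a b c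
  proof -
    have "T $ a $ b $ c = (\<Sum>i\<in>UNIV. \<Sum>j\<in>UNIV. \<Sum>k\<in>UNIV. \<Sum>p<krank T'. F a i * G b j * H c k * (A p $ i * B p $ j * C p $ k))"
      unfolding T by (subst T') (simp add: outer3_def sum_distrib_left)
    also have "\<dots> = (\<Sum>p<krank T'. \<Sum>i\<in>UNIV. \<Sum>j\<in>UNIV. \<Sum>k\<in>UNIV. F a i * G b j * H c k * (A p $ i * B p $ j * C p $ k))"
      by (simp only: sum.swap[where B = "{..<krank T'}"])
    also have "\<dots> = ?r"
      by (simp only: sum_distrib_right mult.assoc) (simp add: sum_distrib_left mult_ac)
    finally show ?thesis .
  qed
  then have "T = (\<Sum>p<krank T'. outer3 (\<chi> a. \<Sum>i\<in>UNIV. F a i * A p $ i) (\<chi> b. \<Sum>j\<in>UNIV. G b j * B p $ j) (\<chi> c. \<Sum>k\<in>UNIV. H c k * C p $ k))"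
    by (simp add: vec_eq_iff outer3_def)
  from krank_le_if_sum[OF _ this] show ?thesis by simp
qed

section \<open>Points with several nearest points in a closed set\<close>

text \<open>The translates by \<open>b / (i + 1)\<close> are pairwise disjoint, have the measure of
  \<open>S\<close> and stay in one ball; so every multiple of this measure is bounded by the volume
  of that ball.\<close>

lemma negligible_if_translates_disjoint:
  fixes S :: "'a::euclidean_space set"
  assumes S: "compact S" and disj: "\<And>x t. x \<in> S \<Longrightarrow> t > 0 \<Longrightarrow> x + t *\<^sub>R b \<notin> S"
  shows "negligible S"
proof -
  obtain M where M: "S \<subseteq> cball 0 M"
    using compact_imp_bounded[OF S] by (auto simp: bounded_iff subset_iff)
  have lm: "S \<in> lmeasurable" using S by (rule lmeasurable_compact)
  define shift where "shift i = (+) (inverse (real (Suc i)) *\<^sub>R b) ` S" for i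
  have shift_disj: "disjnt (shift i) (shift j)" if "i < j" for i j
  proof -
    have "False" if "x \<in> S" "y \<in> S" "inverse (real (Suc i)) *\<^sub>R b + x = inverse (real (Suc j)) *\<^sub>R b + y" for x y
    proof -
      have "y = x + (inverse (real (Suc i)) - inverse (real (Suc j))) *\<^sub>R b"
        using that(3) by (simp add: algebra_simps)
      moreover have "inverse (real (Suc i)) - inverse (real (Suc j)) > 0"
        using \<open>i < j\<close> by simp
      ultimately show False using disj that(1,2) by blast
    qed
    then show ?thesis by (auto simp: shift_def disjnt_def)
  qed
  have sub: "shift i \<subseteq> cball 0 (M + norm b)" for i
  proof -
    have "norm (inverse (real (Suc i)) *\<^sub>R b + x) \<le> M + norm b" if "x \<in> S" for x
    proof -
      have "norm (inverse (real (Suc i)) *\<^sub>R b + x) \<le> norm (inverse (real (Suc i)) *\<^sub>R b) + norm x"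
        by (rule norm_triangle_ineq)
      also have "norm (inverse (real (Suc i)) *\<^sub>R b) \<le> norm b"
        by (simp add: divide_simps mult_left_le field_simps)
      also have "norm x \<le> M" using M that by auto
      finally show ?thesis by simp
    qed
    then show ?thesis by (auto simp: shift_def)
  qed
  have shift_lm: "shift i \<in> lmeasurable" for i
    unfolding shift_def by (rule measurable_translation) (rule lm)
  have "real N * measure lebesgue S \<le> measure lebesgue (cball (0::'a) (M + norm b))" for N
  proof -
    have "real N * measure lebesgue S = (\<Sum>i<N. measure lebesgue (shift i))"
      by (simp add: shift_def measure_translation)
    also have "\<dots> = measure lebesgue (\<Union>i<N. shift i)"
    proof (rule measure_UNION'[symmetric])
      show "pairwise (\<lambda>i j. disjnt (shift i) (shift j)) {..<N}"
        by (simp add: pairwise_def) (metis disjnt_sym linorder_neqE_nat shift_disj)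
    qed (auto intro: shift_lm)
    also have "\<dots> \<le> measure lebesgue (cball (0::'a) (M + norm b))"
      using sub shift_lm by (intro measure_mono_fmeasurable) (auto intro!: fmeasurableD)
    finally show ?thesis .
  qed
  then have "measure lebesgue S \<le> 0"
    by (meson not_le reals_Archimedean3 leD)
  then have "measure lebesgue S = 0" by (simp add: antisym)
  then show ?thesis by (simp add: negligible_iff_measure lm)
qed

definition nearest_points :: "'a::metric_space set \<Rightarrow> 'a \<Rightarrow> 'a set" where
  "nearest_points C x = {c\<in>C. \<forall>y\<in>C. dist x c \<le> dist x y}"

text \<open>With the continuous \<open>infdist\<close> in place of the quantifier over
  \<open>C\<close>, being a nearest point becomes a closed condition on the pair
  \<open>(x, c)\<close> once \<open>C\<close> is closed.\<close>

lemma nearest_points_infdist: "c \<in> nearest_points C x \<longleftrightarrow> c \<in> C \<and> dist x c \<le> infdist x C"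
  unfolding nearest_points_def infdist_def
  by (auto intro: cINF_greatest) (metis cINF_lower2 bdd_below_image_dist order_trans order_refl empty_iff)

text \<open>In the sum of the two minimality inequalities the quadratic terms cancel, leaving
  \<open>t * (d \<bullet> b) \<le> t * (c \<bullet> b)\<close>.\<close>

lemma nearest_points_mono:
  fixes x :: "'a::real_inner"
  assumes "d \<in> nearest_points C x" "c \<in> nearest_points C (x + t *\<^sub>R b)" "t > 0"
  shows "d \<bullet> b \<le> c \<bullet> b"
proof -
  have "dist x d \<le> dist x c" "dist (x + t *\<^sub>R b) c \<le> dist (x + t *\<^sub>R b) d"
    using assms by (auto simp: nearest_points_def)
  then have "(x - d) \<bullet> (x - d) \<le> (x - c) \<bullet> (x - c)"
    "(x + t *\<^sub>R b - c) \<bullet> (x + t *\<^sub>R b - c) \<le> (x + t *\<^sub>R b - d) \<bullet> (x + t *\<^sub>R b - d)"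
    by (auto simp: dist_norm norm_le)
  then have "t * (d \<bullet> b) \<le> t * (c \<bullet> b)"
    by (simp add: inner_diff_left inner_diff_right inner_add_left inner_add_right inner_commute)
  then show ?thesis using \<open>t > 0\<close> by simp
qed

lemma negligible_nonunique_nearest:
  fixes C :: "'a::euclidean_space set"
  assumes C: "closed C"
  shows "negligible {x. \<exists>c\<in>nearest_points C x. \<exists>d\<in>nearest_points C x. c \<noteq> d}"
proof (cases "C = {}")
  case True
  then show ?thesis by (simp add: nearest_points_def)
next
  case False
  then obtain c0 where c0: "c0 \<in> C" by blast
  \<comment> \<open>Different nearest points differ in some coordinate \<open>b\<close>, where a gap
    between two rationals separates them; the bound \<open>n\<close> provides compactness. There are
    countably many such choices.\<close>
  define E where "E = (\<lambda>(b, q1::rat, q2::rat, n::nat). {x. norm x \<le> real n \<and>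
     (\<exists>c\<in>nearest_points C x. \<exists>d\<in>nearest_points C x. c \<bullet> b \<le> of_rat q1 \<and> of_rat q2 \<le> d \<bullet> b)})"
  have neg: "negligible (E (b, q1, q2, n))" if q: "q1 < q2" for b q1 q2 n
  proof (rule negligible_if_translates_disjoint)
    \<comment> \<open>Keeping the two witnesses makes closedness visible; \<open>E\<close> is the
      projection of \<open>G\<close>. Comparison with \<open>c0\<close> bounds the
      witnesses.\<close>
    define G where "G = {(x, c, d). norm x \<le> real n \<and> c \<in> C \<and> d \<in> C \<and> dist x c \<le> infdist x C
       \<and> dist x d \<le> infdist x C \<and> c \<bullet> b \<le> of_rat q1 \<and> of_rat q2 \<le> d \<bullet> b}"
    have "closed G"
      unfolding G_def case_prod_beta
      by (intro closed_Collect_conj closed_Collect_le continuous_intros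
          closed_vimage[of C, unfolded vimage_def] C)
    moreover have "bounded G"
    proof -
      have "norm c \<le> 2 * real n + norm c0" if "norm x \<le> real n" "dist x c \<le> infdist x C" for x c
      proof -
        have "norm c \<le> norm x + dist x c" by (metis dist_0_norm dist_triangle)
        also have "\<dots> \<le> norm x + dist x c0" using that(2) infdist_le[OF c0, of x] by simp
        also have "\<dots> \<le> 2 * real n + norm c0"
          using that(1) norm_triangle_ineq4[of x c0] by (simp add: dist_norm)
        finally show ?thesis .
      qed
      then have "G \<subseteq> cball 0 (real n) \<times> cball 0 (2 * real n + norm c0) \<times> cball 0 (2 * real n + norm c0)"
        by (auto simp: G_def)
      then show ?thesis by (rule bounded_subset[rotated]) (intro bounded_Times bounded_cball)
    qed
    ultimately have "compact (fst ` G)"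
      by (intro compact_continuous_image continuous_intros) (simp add: compact_eq_bounded_closed)
    also have "fst ` G = E (b, q1, q2, n)"
      by (force simp: G_def E_def nearest_points_infdist)
    finally show "compact (E (b, q1, q2, n))" .
  next
    fix x t assume "x \<in> E (b, q1, q2, n)" "(t::real) > 0"
    show "x + t *\<^sub>R b \<notin> E (b, q1, q2, n)"
    proof
      \<comment> \<open>The witnesses are taken crosswise: the one beyond the gap at
        \<open>x\<close>, the one before it at \<open>x + t *\<^sub>R b\<close>. This contradicts
        monotonicity along \<open>b\<close>.\<close>
      assume "x + t *\<^sub>R b \<in> E (b, q1, q2, n)"
      with \<open>x \<in> _\<close> obtain c d where "d \<in> nearest_points C x" "c \<in> nearest_points C (x + t *\<^sub>R b)"
        "c \<bullet> b \<le> of_rat q1" "of_rat q2 \<le> d \<bullet> b" by (auto simp: E_def)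
      moreover have "of_rat q1 < (of_rat q2 :: real)" using q by (simp add: of_rat_less)
      ultimately show False using nearest_points_mono[of d C x c t b] \<open>t > 0\<close> by linarith
    qed
  qed
  define I where "I = {(b, q1, q2, n). b \<in> (Basis::'a set) \<and> (q1::rat) < q2 \<and> (n::nat) \<in> UNIV}"
  have "I \<subseteq> Basis \<times> UNIV \<times> UNIV \<times> UNIV" by (auto simp: I_def)
  moreover have "countable ((Basis::'a set) \<times> (UNIV::rat set) \<times> (UNIV::rat set) \<times> (UNIV::nat set))"
    by (simp add: countable_finite)
  ultimately have "countable I" by (rule countable_subset)
  moreover have "negligible (E i)" if "i \<in> I" for i using neg that by (auto simp: I_def)
  ultimately have "negligible (\<Union>(E ` I))"
    by (auto intro: negligible_countable_Union)
  moreover have "{x. \<exists>c\<in>nearest_points C x. \<exists>d\<in>nearest_points C x. c \<noteq> d} \<subseteq> \<Union>(E ` I)"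
  proof clarify
    fix x c d assume cd: "c \<in> nearest_points C x" "d \<in> nearest_points C x" "c \<noteq> d"
    \<comment> \<open>Stated for arbitrary \<open>c\<close> and \<open>d\<close>, since either of
      the two nearest points may have the smaller coordinate.\<close>
    have key: "x \<in> \<Union>(E ` I)" if "b \<in> Basis" and lt: "c \<bullet> b < d \<bullet> b" and "c \<in> nearest_points C x" "d \<in> nearest_points C x" for b c d
    proof -
      obtain q1 where q1: "c \<bullet> b < of_rat q1" "of_rat q1 < d \<bullet> b" using of_rat_dense[OF lt] by blast
      obtain q2 where q2: "of_rat q1 < (of_rat q2 :: real)" "of_rat q2 < d \<bullet> b" using of_rat_dense[OF q1(2)] by blast
      obtain n where "norm x \<le> real n" using real_arch_simple by blast
      with q1 q2 \<open>b \<in> Basis\<close> \<open>c \<in> nearest_points C x\<close> \<open>d \<in> nearest_points C x\<close> have "(b, q1, q2, n) \<in> I" "x \<in> E (b, q1, q2, n)"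
        by (auto simp: I_def E_def of_rat_less intro: less_imp_le)
      then show ?thesis by blast
    qed
    obtain b where "b \<in> Basis" "c \<bullet> b \<noteq> d \<bullet> b" using cd(3) euclidean_eq_iff by blast
    then show "x \<in> \<Union>(E ` I)" using key cd(1,2) by (metis linorder_neqE)
  qed
  ultimately show ?thesis by (rule negligible_subset)
qed

section \<open>Slice mixes and generalised eigenvectors\<close>

lemma matrix_vector_mult_scale: "A *v (c *s x) = c *s (A *v x)" for A :: "'a::field^'n::finite^'m::finite"
  by (simp add: matrix_vector_mult_def vec_eq_iff sum_distrib_left mult_ac)

definition of_columns :: "('n \<Rightarrow> 'a^'m) \<Rightarrow> 'a^'n^'m" where
  "of_columns v = (\<chi> i q. v q $ i)"

lemma of_columns_mult: "of_columns v *v x = (\<Sum>q\<in>UNIV. x $ q *s v q)"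
  for v :: "'n::finite \<Rightarrow> 'a::field^'m::finite"
  by (simp add: matrix_vector_mult_def of_columns_def vec_eq_iff mult_ac)

lemma invertible_iff_ker: "invertible A \<longleftrightarrow> (\<forall>x. A *v x = 0 \<longrightarrow> x = 0)"
  for A :: "'a::field^'n::finite^'n"
  by (simp add: invertible_left_inverse matrix_left_invertible_ker)

lemma invertible_inj: "invertible A \<Longrightarrow> A *v x = A *v y \<Longrightarrow> x = y"
  for A :: "'a::field^'n::finite^'n"
  by (metis invertible_left_inverse matrix_vector_mul_assoc matrix_vector_mul_lid)

lemma invertible_surj: "invertible A \<Longrightarrow> \<exists>x. A *v x = y"
  for A :: "'a::field^'n::finite^'n"
  by (metis invertible_right_inverse matrix_vector_mul_assoc matrix_vector_mul_lid)

text \<open>Subtracting \<open>\<mu> x\<close> times a vanishing combination from its image under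
  \<open>A\<close> removes the term at \<open>x\<close> and multiplies the others by nonzero
  numbers; so independence follows by induction.\<close>

lemma invertible_of_eigenvectors:
  fixes A :: "'a::field^'n::finite^'n"
  assumes eig: "\<And>q. A *v v q = \<mu> q *s v q" and nz: "\<And>q. v q \<noteq> 0" and inj: "inj (\<mu> :: 'n \<Rightarrow> 'a)"
  shows "invertible (of_columns v)"
proof -
  have "\<forall>q\<in>S. c q = 0" if "finite S" "(\<Sum>q\<in>S. c q *s v q) = 0" for S c
    using that
  proof (induction S arbitrary: c rule: finite_induct)
    case (insert x S)
    have "0 = A *v (\<Sum>q\<in>insert x S. c q *s v q) - \<mu> x *s (\<Sum>q\<in>insert x S. c q *s v q)"
      by (simp only: insert.prems) (simp add: vec_eq_iff matrix_vector_mult_def)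
    also have "A *v (\<Sum>q\<in>insert x S. c q *s v q) = (\<Sum>q\<in>insert x S. c q *s (\<mu> q *s v q))"
      by (simp add: vec.linear_sum[OF matrix_vector_mul_linear_gen] matrix_vector_mult_scale eig)
    also have "\<dots> - \<mu> x *s (\<Sum>q\<in>insert x S. c q *s v q) = (\<Sum>q\<in>insert x S. (c q * (\<mu> q - \<mu> x)) *s v q)"
      by (simp only: vec.scale_sum_right sum_subtractf[symmetric])
        (intro sum.cong refl, simp add: vec_eq_iff algebra_simps)
    also have "\<dots> = (\<Sum>q\<in>S. (c q * (\<mu> q - \<mu> x)) *s v q)"
      using insert.hyps by simp
    finally have "\<forall>q\<in>S. c q * (\<mu> q - \<mu> x) = 0" using insert.IH by metis
    then have S0: "\<forall>q\<in>S. c q = 0" using inj insert.hyps(2) by (auto dest: injD)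
    then have "c x *s v x = 0" using insert.prems insert.hyps by simp
    then have "c x = 0" using nz[of x] by simp
    then show ?case using S0 by simp
  qed simp
  from this[of UNIV] show ?thesis
    by (auto simp: invertible_iff_ker of_columns_mult vec_eq_iff)
qed

lemma slice_mix_nth: "slice_mix X \<gamma> $ a $ b = (\<Sum>k\<in>UNIV. \<gamma> $ k * X $ a $ b $ k)"
  by (simp add: slice_mix_def slice_def)

lemma slice_mix_axis: "slice_mix X (axis k 1) $ a $ b = X $ a $ b $ k"
  by (simp add: slice_mix_nth axis_def if_distrib[where f="\<lambda>x. x * _"] cong: if_cong)

text \<open>Only the weights \<open>scalar_product (C p) \<gamma>\<close> depend on
  \<open>\<gamma>\<close>: all mixes of a decomposed tensor share the outer factors. Uniqueness and
  the passage to limits both rest on this.\<close>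

lemma slice_mix_sum_outer3:
  fixes A B :: "'p::finite \<Rightarrow> 'a::field^'r::finite" and C :: "'p \<Rightarrow> 'a^'k::finite"
  shows "slice_mix (\<Sum>p\<in>UNIV. outer3 (A p) (B p) (C p)) \<gamma>
    = of_columns A ** (\<chi> p j. scalar_product (C p) \<gamma> * B p $ j)"
proof -
  have "slice_mix (\<Sum>p\<in>UNIV. outer3 (A p) (B p) (C p)) \<gamma> $ a $ b
    = (\<Sum>p\<in>UNIV. A p $ a * (scalar_product (C p) \<gamma> * B p $ b))" for a b
    unfolding slice_mix_nth scalar_product_def
    by (simp add: outer3_def sum_distrib_left sum_distrib_right, subst sum.swap) (simp add: mult_ac)
  then show ?thesis
    by (simp add: vec_eq_iff matrix_matrix_mult_def of_columns_def)
qed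

lemma slice_mix_sum_outer3_vec:
  fixes A B :: "'p::finite \<Rightarrow> 'a::field^'r::finite" and C :: "'p \<Rightarrow> 'a^'k::finite"
  shows "slice_mix (\<Sum>p\<in>UNIV. outer3 (A p) (B p) (C p)) \<gamma> *v x
    = of_columns A *v (\<chi> p. scalar_product (C p) \<gamma> * scalar_product (B p) x)"
proof -
  have "(\<chi> p j. scalar_product (C p) \<gamma> * B p $ j) *v x
      = (\<chi> p. scalar_product (C p) \<gamma> * scalar_product (B p) x)"
    by (simp add: vec_eq_iff matrix_vector_mult_def scalar_product_def sum_distrib_left mult_ac)
  then show ?thesis
    by (simp add: slice_mix_sum_outer3 matrix_vector_mul_assoc[symmetric])
qed

text \<open>What simplicity of a pencil of mixed slices amounts to: a full set of distinct generalised
  eigenvalues in the scalar field, so that the eigenvectors form a basis.\<close>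

definition simple_spectrum ::
  "('a::field,'r::finite,'r,'k::finite) tensor \<Rightarrow> 'a^'k \<Rightarrow> 'a^'k \<Rightarrow> ('r \<Rightarrow> 'a) \<Rightarrow> ('r \<Rightarrow> 'a^'r) \<Rightarrow> bool" where
  "simple_spectrum X \<gamma>\<^sub>0 \<gamma>\<^sub>1 \<mu> v \<longleftrightarrow> invertible (slice_mix X \<gamma>\<^sub>0) \<and> inj \<mu> \<and>
     (\<forall>q. v q \<noteq> 0 \<and> slice_mix X \<gamma>\<^sub>1 *v v q = \<mu> q *s (slice_mix X \<gamma>\<^sub>0 *v v q))"

text \<open>In dimension two the linear forms vanishing at a nonzero \<open>w\<close> fill a line,
  spanned by \<open>w\<close> with its entries swapped and one sign changed.\<close>

lemma proportional_if_common_zero: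
  fixes f g w :: "'a::field^2"
  assumes "(\<Sum>k\<in>UNIV. f $ k * w $ k) = 0" "(\<Sum>k\<in>UNIV. g $ k * w $ k) = 0" "w \<noteq> 0"
  shows "proportional f g"
proof -
  have f: "f $ 1 * w $ 1 + f $ 2 * w $ 2 = 0" and g: "g $ 1 * w $ 1 + g $ 2 * w $ 2 = 0"
    using assms by (simp_all add: sum_2)
  define u :: "'a^2" where "u = (\<chi> i. if i = 1 then - (w $ 2) else w $ 1)"
  have mult: "\<exists>s. h = s *s u" if "h $ 1 * w $ 1 + h $ 2 * w $ 2 = 0" for h :: "'a^2"
  proof (cases "w $ 1 = 0")
    case True
    then have "w $ 2 \<noteq> 0" using assms(3) by (auto simp: vec_eq_iff forall_2)
    with True that show ?thesis
      by (intro exI[of _ "- h $ 1 / w $ 2"]) (simp add: vec_eq_iff forall_2 u_def)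
  next
    case False
    then show ?thesis using that
      by (intro exI[of _ "h $ 2 / w $ 1"]) (simp add: vec_eq_iff forall_2 u_def field_simps eq_neg_iff_add_eq_0)
  qed
  obtain s t where st: "f = s *s u" "g = t *s u" using mult[OF f] mult[OF g] by blast
  show ?thesis
  proof (cases "s = 0")
    case True then show ?thesis unfolding proportional_def st by (intro disjI1 exI[of _ 0]) simp
  next
    case False then show ?thesis unfolding proportional_def st by (intro disjI2 exI[of _ "t / s"]) simp
  qed
qed

text \<open>Removes \<open>U\<close> from the argument: spectral data of a pencil become data of
  \<open>X\<close> itself.\<close>

lemma slice_mix_pencil:
  "slice_mix (pencil (mode3_mult X U) e i) \<delta>
    = slice_mix X (\<chi> k. \<delta> $ 1 * U $ e (2 * i - 1) $ k + \<delta> $ 2 * U $ e (2 * i) $ k)"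
  for X :: "('a::field,'r::finite,'r,'k::finite) tensor"
  by (simp add: vec_eq_iff slice_mix_nth sum_2 pencil_def mode3_mult_def sum_distrib_left
      sum.distrib distrib_right mult.assoc)

text \<open>Each linear factor of the determinant vanishes at a combination
  \<open>\<delta>\<^sub>1 - \<mu> q *s \<delta>\<^sub>0\<close>, which gives one eigenvalue per
  factor. Equal eigenvalues would give two factors a common nonzero zero and make them
  proportional.\<close>

lemma simple_spectrum_if_simple_pencil:
  fixes X :: "('a::field,'r::finite,'r,'k::finite) tensor"
  assumes "simple_tensor (pencil (mode3_mult X U) e i)"
  shows "\<exists>\<gamma>\<^sub>0 \<gamma>\<^sub>1 \<mu> v. simple_spectrum X \<gamma>\<^sub>0 \<gamma>\<^sub>1 \<mu> v"
proof -
  let ?P = "pencil (mode3_mult X U) e i"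
  define L where "L f \<delta> = (\<Sum>k\<in>UNIV. f $ k * \<delta> $ k)" for f \<delta> :: "'a^2"
  obtain \<delta>\<^sub>0 where inv0: "invertible (slice_mix ?P \<delta>\<^sub>0)"
    using assms unfolding simple_tensor_def slice_mix_invertible_def by blast
  obtain f :: "nat \<Rightarrow> 'a^2" where
    np: "\<And>p q. p < CARD('r) \<Longrightarrow> q < CARD('r) \<Longrightarrow> p \<noteq> q \<Longrightarrow> \<not> proportional (f p) (f q)"
    and det: "\<And>\<delta>. det (slice_mix ?P \<delta>) = (\<Prod>p<CARD('r). L (f p) \<delta>)"
    using assms unfolding simple_tensor_def L_def by blast
  have f0: "L (f p) \<delta>\<^sub>0 \<noteq> 0" if "p < CARD('r)" for p
    using inv0 that by (auto simp: invertible_det_nz det)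
  \<comment> \<open>A unit vector that is no multiple of \<open>\<delta>\<^sub>0\<close>, so that
    the zeros of the factors found below are nonzero vectors.\<close>
  define \<delta>\<^sub>1 :: "'a^2" where "\<delta>\<^sub>1 = (if \<delta>\<^sub>0 $ 1 = 0 then axis 1 1 else axis 2 1)"
  have ind: "\<delta>\<^sub>1 - c *s \<delta>\<^sub>0 \<noteq> 0" for c
    by (auto simp: \<delta>\<^sub>1_def vec_eq_iff forall_2 axis_def)
  obtain h where h: "bij_betw h (UNIV::'r set) {0..<CARD('r)}"
    using ex_bij_betw_finite_nat[of "UNIV::'r set"] by auto
  then have h_less: "h q < CARD('r)" for q by (auto simp: bij_betw_def)
  define \<mu> where "\<mu> q = L (f (h q)) \<delta>\<^sub>1 / L (f (h q)) \<delta>\<^sub>0" for q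
  have L0: "L (f (h q)) (\<delta>\<^sub>1 - \<mu> q *s \<delta>\<^sub>0) = 0" for q
  proof -
    have "L (f (h q)) (\<delta>\<^sub>1 - \<mu> q *s \<delta>\<^sub>0) = L (f (h q)) \<delta>\<^sub>1 - \<mu> q * L (f (h q)) \<delta>\<^sub>0"
      by (simp add: L_def sum_2 algebra_simps)
    then show ?thesis using f0[OF h_less] by (simp add: \<mu>_def)
  qed
  have "inj \<mu>"
  proof (rule injI)
    fix p q assume eq: "\<mu> p = \<mu> q"
    have "proportional (f (h p)) (f (h q))"
      using L0[of p, unfolded eq L_def] L0[of q, unfolded L_def] ind
      by (rule proportional_if_common_zero)
    then have "h p = h q" using np h_less by blast
    then show "p = q" using h by (auto simp: bij_betw_def dest: injD)
  qed
  have "\<exists>v. v \<noteq> 0 \<and> slice_mix ?P \<delta>\<^sub>1 *v v = \<mu> q *s (slice_mix ?P \<delta>\<^sub>0 *v v)" for q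
  proof -
    have "(\<Prod>p<CARD('r). L (f p) (\<delta>\<^sub>1 - \<mu> q *s \<delta>\<^sub>0)) = 0"
      using L0[of q] h_less[of q] by (intro prod_zero) auto
    then have "\<not> invertible (slice_mix ?P (\<delta>\<^sub>1 - \<mu> q *s \<delta>\<^sub>0))"
      by (simp add: invertible_det_nz det)
    then obtain v where v: "v \<noteq> 0" "slice_mix ?P (\<delta>\<^sub>1 - \<mu> q *s \<delta>\<^sub>0) *v v = 0"
      by (auto simp: invertible_iff_ker)
    have "slice_mix ?P (\<delta>\<^sub>1 - \<mu> q *s \<delta>\<^sub>0) *v v = slice_mix ?P \<delta>\<^sub>1 *v v - \<mu> q *s (slice_mix ?P \<delta>\<^sub>0 *v v)"
      by (simp add: vec_eq_iff matrix_vector_mult_def slice_mix_nth sum_2 sum_subtractf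
          sum.distrib sum_distrib_left algebra_simps)
    with v show ?thesis by auto
  qed
  then obtain v where "\<And>q. v q \<noteq> 0 \<and> slice_mix ?P \<delta>\<^sub>1 *v v q = \<mu> q *s (slice_mix ?P \<delta>\<^sub>0 *v v q)"
    by metis
  with inv0 \<open>inj \<mu>\<close> show ?thesis
    unfolding slice_mix_pencil simple_spectrum_def by blast
qed

text \<open>Multiplying by the inverse of \<open>slice_mix X \<gamma>\<^sub>0\<close> turns
  generalised eigenvectors into ordinary ones.\<close>

lemma simple_spectrum_basis:
  assumes "simple_spectrum X \<gamma>\<^sub>0 \<gamma>\<^sub>1 \<mu> v"
  shows "invertible (of_columns v)"
proof -
  obtain N where N: "N ** slice_mix X \<gamma>\<^sub>0 = mat 1"
    using assms by (auto simp: simple_spectrum_def invertible_left_inverse)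
  have "(N ** slice_mix X \<gamma>\<^sub>1) *v v q = \<mu> q *s v q" for q
  proof -
    have "(N ** slice_mix X \<gamma>\<^sub>1) *v v q = \<mu> q *s ((N ** slice_mix X \<gamma>\<^sub>0) *v v q)"
      using assms
      by (simp add: simple_spectrum_def matrix_vector_mul_assoc[symmetric] matrix_vector_mult_scale)
    then show ?thesis by (simp add: N)
  qed
  then show ?thesis
    by (rule invertible_of_eigenvectors) (use assms in \<open>auto simp: simple_spectrum_def\<close>)
qed

section \<open>Uniqueness of decompositions\<close>

text \<open>In coordinates along the columns of \<open>A\<close>, the eigenvalue equation says that
  a \<open>B p\<close> not annihilating \<open>v q\<close> fixes \<open>\<mu> q\<close> as a
  quotient depending on \<open>p\<close> only. The eigenvalues being distinct, each
  \<open>B p\<close> detects at most one \<open>v q\<close>; invertibility at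
  \<open>\<gamma>\<^sub>0\<close> makes every \<open>v q\<close> detected.\<close>

lemma decomp_dual_to_eigenvectors:
  fixes X :: "('a::field,'r::finite,'r,'k::finite) tensor"
  assumes sp: "simple_spectrum X \<gamma>\<^sub>0 \<gamma>\<^sub>1 \<mu> v"
    and X: "X = (\<Sum>p\<in>(UNIV::'r set). outer3 (A p) (B p) (C p))"
  obtains \<tau> where "bij \<tau>" "\<And>q. scalar_product (B (\<tau> q)) (v q) \<noteq> 0"
    "\<And>q q'. q' \<noteq> q \<Longrightarrow> scalar_product (B (\<tau> q)) (v q') = 0"
    "\<And>q \<gamma>. slice_mix X \<gamma> *v v q = (scalar_product (C (\<tau> q)) \<gamma> * scalar_product (B (\<tau> q)) (v q)) *s A (\<tau> q)"
proof -
  have inv0: "invertible (slice_mix X \<gamma>\<^sub>0)" and inj: "inj \<mu>" and nz: "\<And>q. v q \<noteq> 0"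
    and eig: "\<And>q. slice_mix X \<gamma>\<^sub>1 *v v q = \<mu> q *s (slice_mix X \<gamma>\<^sub>0 *v v q)"
    using sp by (auto simp: simple_spectrum_def)
  let ?A = "of_columns A" and ?s = scalar_product
  have mix: "slice_mix X \<gamma> *v x = ?A *v (\<chi> p. ?s (C p) \<gamma> * ?s (B p) x)" for \<gamma> x
    unfolding X by (rule slice_mix_sum_outer3_vec)
  have invA: "invertible ?A"
    using inv0 unfolding X slice_mix_sum_outer3 invertible_right_inverse matrix_mul_assoc[symmetric] by blast
  \<comment> \<open>Otherwise the \<open>p\<close>-th column of \<open>A\<close> would lie outside
    the range of \<open>slice_mix X \<gamma>\<^sub>0\<close>, which is the whole space.\<close>
  have "?s (C p) \<gamma>\<^sub>0 \<noteq> 0" for p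
  proof
    assume 0: "?s (C p) \<gamma>\<^sub>0 = 0"
    obtain x where "slice_mix X \<gamma>\<^sub>0 *v x = ?A *v axis p 1" using invertible_surj[OF inv0] by blast
    then have "(\<chi> p. ?s (C p) \<gamma>\<^sub>0 * ?s (B p) x) = axis p 1"
      unfolding mix by (rule invertible_inj[OF invA])
    then show False using 0 by (auto simp: vec_eq_iff axis_def dest: spec[of _ p])
  qed
  note C0 = this
  have B: "?s (B p) (v q) = 0 \<or> \<mu> q = ?s (C p) \<gamma>\<^sub>1 / ?s (C p) \<gamma>\<^sub>0" for p q
  proof -
    have "?A *v (\<chi> p. ?s (C p) \<gamma>\<^sub>1 * ?s (B p) (v q)) = ?A *v (\<mu> q *s (\<chi> p. ?s (C p) \<gamma>\<^sub>0 * ?s (B p) (v q)))"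
      using eig[of q] by (simp add: mix matrix_vector_mult_scale)
    from invertible_inj[OF invA this]
    have "?s (C p) \<gamma>\<^sub>1 * ?s (B p) (v q) = \<mu> q * (?s (C p) \<gamma>\<^sub>0 * ?s (B p) (v q))"
      by (simp add: vec_eq_iff)
    then show ?thesis using C0[of p] by (auto simp: field_simps)
  qed
  have "\<exists>p. ?s (B p) (v q) \<noteq> 0" for q
  proof (rule ccontr)
    assume "\<nexists>p. ?s (B p) (v q) \<noteq> 0"
    then have "slice_mix X \<gamma>\<^sub>0 *v v q = 0" by (simp add: mix of_columns_mult)
    then show False using inv0 nz unfolding invertible_iff_ker by blast
  qed
  then obtain \<tau> where \<tau>: "\<And>q. ?s (B (\<tau> q)) (v q) \<noteq> 0" by metis
  have \<tau>0: "?s (B (\<tau> q)) (v q') = 0" if "q' \<noteq> q" for q q'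
    using B[of "\<tau> q" q] B[of "\<tau> q" q'] \<tau>[of q] that inj by (metis injD)
  have "inj \<tau>" by (rule injI) (metis \<tau> \<tau>0)
  then have "bij \<tau>" by (simp add: bij_def finite_UNIV_inj_surj)
  have "slice_mix X \<gamma> *v v q = (?s (C (\<tau> q)) \<gamma> * ?s (B (\<tau> q)) (v q)) *s A (\<tau> q)" for q \<gamma>
  proof -
    have z: "?s (B p) (v q) = 0" if "p \<noteq> \<tau> q" for p
      using \<tau>0 that by (metis \<open>bij \<tau>\<close> bij_pointE)
    have "slice_mix X \<gamma> *v v q = (\<Sum>p\<in>UNIV. (?s (C p) \<gamma> * ?s (B p) (v q)) *s A p)"
      by (simp add: mix of_columns_mult)
    also have "\<dots> = (\<Sum>p\<in>{\<tau> q}. (?s (C p) \<gamma> * ?s (B p) (v q)) *s A p)"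
      by (rule sum.mono_neutral_right) (auto simp: z)
    finally show ?thesis by simp
  qed
  from that[OF \<open>bij \<tau>\<close> \<tau> \<tau>0 this] show thesis .
qed

text \<open>The vectors \<open>slice_mix X \<gamma> *v v q\<close> do not depend on the
  decomposition. Comparing their two expressions matches the first and third factors; duality to the
  basis \<open>v\<close> matches the second.\<close>

lemma decomp_unique:
  fixes X :: "('a::field,'r::finite,'r,'k::finite) tensor"
  assumes sp: "simple_spectrum X \<gamma>\<^sub>0 \<gamma>\<^sub>1 \<mu> v"
    and X: "X = (\<Sum>p\<in>(UNIV::'r set). outer3 (A p) (B p) (C p))"
    and X': "X = (\<Sum>p\<in>(UNIV::'r set). outer3 (A' p) (B' p) (C' p))"
  obtains \<rho> where "bij \<rho>" "\<And>p. \<exists>\<alpha> \<beta> \<gamma>. A' p = \<alpha> *s A (\<rho> p) \<and> B' p = \<beta> *s B (\<rho> p) \<and> C' p = \<gamma> *s C (\<rho> p)"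
proof -
  let ?s = scalar_product
  obtain \<tau> where \<tau>: "bij \<tau>" "\<And>q. ?s (B (\<tau> q)) (v q) \<noteq> 0"
    "\<And>q q'. q' \<noteq> q \<Longrightarrow> ?s (B (\<tau> q)) (v q') = 0"
    "\<And>q \<gamma>. slice_mix X \<gamma> *v v q = (?s (C (\<tau> q)) \<gamma> * ?s (B (\<tau> q)) (v q)) *s A (\<tau> q)"
    by (rule decomp_dual_to_eigenvectors[OF sp X]) (rule that)
  obtain \<tau>' where \<tau>': "bij \<tau>'" "\<And>q. ?s (B' (\<tau>' q)) (v q) \<noteq> 0"
    "\<And>q q'. q' \<noteq> q \<Longrightarrow> ?s (B' (\<tau>' q)) (v q') = 0"
    "\<And>q \<gamma>. slice_mix X \<gamma> *v v q = (?s (C' (\<tau>' q)) \<gamma> * ?s (B' (\<tau>' q)) (v q)) *s A' (\<tau>' q)"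
    by (rule decomp_dual_to_eigenvectors[OF sp X']) (rule that)
  have mul: "\<exists>\<alpha> \<beta> \<gamma>. A' (\<tau>' q) = \<alpha> *s A (\<tau> q) \<and> B' (\<tau>' q) = \<beta> *s B (\<tau> q) \<and> C' (\<tau>' q) = \<gamma> *s C (\<tau> q)" for q
  proof -
    define a b c a' b' c' where "a = A (\<tau> q)" "b = ?s (B (\<tau> q)) (v q)" "c = C (\<tau> q)"
      "a' = A' (\<tau>' q)" "b' = ?s (B' (\<tau>' q)) (v q)" "c' = C' (\<tau>' q)"
    note abc = this
    have bnz: "b \<noteq> 0" "b' \<noteq> 0" using \<tau>(2) \<tau>'(2) by (auto simp: abc)
    have eq: "(?s c \<gamma> * b) *s a = (?s c' \<gamma> * b') *s a'" for \<gamma>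
      using \<tau>(4)[of \<gamma> q] \<tau>'(4)[of \<gamma> q] by (simp add: abc)
    have "slice_mix X \<gamma>\<^sub>0 *v v q \<noteq> 0"
      using sp by (auto simp: simple_spectrum_def invertible_iff_ker)
    then have nz: "?s c \<gamma>\<^sub>0 \<noteq> 0" "a \<noteq> 0" "?s c' \<gamma>\<^sub>0 \<noteq> 0" "a' \<noteq> 0"
      using \<tau>(4)[of \<gamma>\<^sub>0 q] \<tau>'(4)[of \<gamma>\<^sub>0 q] by (auto simp: abc)
    define \<kappa> where "\<kappa> = (?s c \<gamma>\<^sub>0 * b) / (?s c' \<gamma>\<^sub>0 * b')"
    have "a' = (1 / (?s c' \<gamma>\<^sub>0 * b')) *s ((?s c' \<gamma>\<^sub>0 * b') *s a')" using nz bnz by simp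
    also have "\<dots> = \<kappa> *s a" by (simp add: eq[symmetric] \<kappa>_def)
    finally have A: "a' = \<kappa> *s a" .
    have \<kappa>: "\<kappa> \<noteq> 0" using nz bnz by (simp add: \<kappa>_def)
    have "?s c \<gamma> * b = ?s c' \<gamma> * b' * \<kappa>" for \<gamma>
      using eq[of \<gamma>] nz(2) by (simp add: A)
    from this[of "axis k 1" for k] have "c $ k * b = c' $ k * b' * \<kappa>" for k
      by (simp add: scalar_product_def axis_def if_distrib cong: if_cong)
    then have Cc: "c' = (b / (b' * \<kappa>)) *s c"
      using bnz \<kappa> by (simp add: vec_eq_iff field_simps)
    \<comment> \<open>Pairing with \<open>v q\<close> forces the scale \<open>b' / b\<close>; the
      other eigenvectors annihilate both terms, and only zero is annihilated by a whole
      basis.\<close>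
    define x where "x = B' (\<tau>' q) - (b' / b) *s B (\<tau> q)"
    have xv: "?s x (v q') = 0" for q'
    proof -
      have "?s x (v q') = ?s (B' (\<tau>' q)) (v q') - (b' / b) * ?s (B (\<tau> q)) (v q')"
        by (simp add: x_def scalar_product_def algebra_simps sum_subtractf sum_distrib_left)
      then show ?thesis using bnz \<tau>(3) \<tau>'(3) by (cases "q' = q") (auto simp: abc)
    qed
    have "x = 0"
    proof -
      have "invertible (transpose (of_columns v))"
        using simple_spectrum_basis[OF sp] by (simp add: invertible_det_nz)
      moreover have "transpose (of_columns v) *v x = 0"
        using xv by (simp add: vec_eq_iff transpose_def of_columns_def matrix_vector_mult_def
            scalar_product_def mult.commute)
      ultimately show ?thesis by (simp add: invertible_iff_ker)
    qed
    then have "B' (\<tau>' q) = (b' / b) *s B (\<tau> q)" by (simp add: x_def)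
    with A Cc show ?thesis unfolding abc by blast
  qed
  show thesis
  proof (rule that)
    show "bij (\<tau> \<circ> inv \<tau>')" using \<tau>(1) \<tau>'(1) by (simp add: bij_comp bij_imp_bij_inv)
    show "\<exists>\<alpha> \<beta> \<gamma>. A' p = \<alpha> *s A ((\<tau> \<circ> inv \<tau>') p) \<and> B' p = \<beta> *s B ((\<tau> \<circ> inv \<tau>') p) \<and> C' p = \<gamma> *s C ((\<tau> \<circ> inv \<tau>') p)" for p
      using mul[of "inv \<tau>' p"] \<tau>'(1) by (simp add: bij_def surj_f_inv_f)
  qed
qed

lemma unique_CPD_if_simple_spectrum:
  fixes X :: "('a::field,'r::finite,'r,'k::finite) tensor"
  assumes sp: "simple_spectrum X \<gamma>\<^sub>0 \<gamma>\<^sub>1 \<mu> v" and rank: "krank X = CARD('r)"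
  shows "unique_CPD X"
  unfolding unique_CPD_def
proof (intro conjI allI impI)
  show "\<exists>A B C. is_CPD X A B C" by (rule ex_is_CPD)
  fix A B C A' B' C' assume CPD: "is_CPD X A B C" "is_CPD X A' B' C'"
  let ?R = "{..<krank X}"
  obtain h where h: "bij_betw h (UNIV::'r set) ?R"
    using ex_bij_betw_finite_nat[of "UNIV::'r set"] rank by (auto simp: atLeast0LessThan)
  have reindex: "X = (\<Sum>p\<in>(UNIV::'r set). outer3 (A (h p)) (B (h p)) (C (h p)))" if "is_CPD X A B C" for A B C
    using that sum.reindex_bij_betw[OF h, of "\<lambda>p. outer3 (A p) (B p) (C p)"]
    by (simp add: is_CPD_def is_decomp_def)
  obtain \<rho> where \<rho>: "bij \<rho>" "\<And>p. \<exists>\<alpha> \<beta> \<gamma>. A' (h p) = \<alpha> *s A (h (\<rho> p)) \<and> B' (h p) = \<beta> *s B (h (\<rho> p)) \<and> C' (h p) = \<gamma> *s C (h (\<rho> p))"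
    by (rule decomp_unique[OF sp reindex[OF CPD(1)] reindex[OF CPD(2)]]) (rule that)
  define g where "g = inv_into UNIV h"
  have g: "bij_betw g ?R UNIV" and hg: "\<And>p. p \<in> ?R \<Longrightarrow> h (g p) = p"
    using h unfolding g_def by (auto simp: bij_betw_inv_into bij_betw_inv_into_right)
  \<comment> \<open>\<open>permutes\<close> requires the identity outside \<open>?R\<close>, hence
    the second case.\<close>
  define \<sigma> where "\<sigma> p = (if p \<in> ?R then h (\<rho> (g p)) else p)" for p
  have "bij_betw (h \<circ> \<rho> \<circ> g) ?R ?R"
    using g \<rho>(1) h by (auto intro: bij_betw_trans)
  then have "bij_betw \<sigma> ?R ?R"
    by (rule bij_betw_cong[THEN iffD1, rotated]) (simp add: \<sigma>_def)
  then have perm: "\<sigma> permutes ?R"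
    by (rule bij_imp_permutes) (simp add: \<sigma>_def)
  have "\<forall>p. \<exists>\<alpha> \<beta> \<gamma>. p \<in> ?R \<longrightarrow> A' p = \<alpha> *s A (\<sigma> p) \<and> B' p = \<beta> *s B (\<sigma> p) \<and> C' p = \<gamma> *s C (\<sigma> p)"
  proof
    fix p show "\<exists>\<alpha> \<beta> \<gamma>. p \<in> ?R \<longrightarrow> A' p = \<alpha> *s A (\<sigma> p) \<and> B' p = \<beta> *s B (\<sigma> p) \<and> C' p = \<gamma> *s C (\<sigma> p)"
      using \<rho>(2)[of "g p"] hg[of p] by (cases "p \<in> ?R") (simp_all add: \<sigma>_def)
  qed
  then obtain \<alpha> \<beta> \<gamma> where "\<And>p. p \<in> ?R \<longrightarrow> A' p = \<alpha> p *s A (\<sigma> p) \<and> B' p = \<beta> p *s B (\<sigma> p) \<and> C' p = \<gamma> p *s C (\<sigma> p)"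
    by metis
  with perm show "\<exists>\<sigma> \<alpha> \<beta> \<gamma>. \<sigma> permutes ?R \<and>
     (\<forall>p<krank X. A' p = \<alpha> p *s A (\<sigma> p) \<and> B' p = \<beta> p *s B (\<sigma> p) \<and> C' p = \<gamma> p *s C (\<sigma> p))"
    by blast
qed

section \<open>The rank bound under limits\<close>

text \<open>The slice mixes are products \<open>A D B'\<close> with \<open>D\<close> diagonal. The
  matrix \<open>G = B' N A\<close> between two of them is inverse to the diagonal matrix at
  \<open>\<gamma>\<^sub>0\<close>, hence diagonal, and diagonal matrices commute.\<close>

lemma slice_mix_commute:
  fixes X :: "('a::field,'r::finite,'r,'k::finite) tensor"
  assumes "krank X \<le> CARD('r)" and N: "slice_mix X \<gamma>\<^sub>0 ** N = mat 1"
  shows "slice_mix X \<gamma> ** N ** slice_mix X \<gamma>' = slice_mix X \<gamma>' ** N ** slice_mix X \<gamma>"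
proof -
  obtain A B C where X: "X = (\<Sum>p\<in>(UNIV::'r set). outer3 (A p) (B p) (C p))"
    using sum_if_krank_le[OF assms(1)] by blast
  define D where "D \<gamma> = (\<chi> p q. if p = q then scalar_product (C p) \<gamma> else 0 :: 'a^'r^'r)" for \<gamma>
  define B' where "B' = (\<chi> p j. B p $ j)"
  have D_left: "(D \<gamma> ** M) $ p $ q = scalar_product (C p) \<gamma> * M $ p $ q" for \<gamma> M p q
    by (simp add: D_def matrix_matrix_mult_def if_distrib[where f = "\<lambda>x. x * _"] cong: if_cong)
  have D_right: "(M ** D \<gamma>) $ p $ q = M $ p $ q * scalar_product (C q) \<gamma>" for \<gamma> M p q
    by (simp add: D_def matrix_matrix_mult_def if_distrib[where f = "\<lambda>x. _ * x"] cong: if_cong)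
  have mix: "slice_mix X \<gamma> = of_columns A ** (D \<gamma> ** B')" for \<gamma>
    unfolding X slice_mix_sum_outer3
    by (rule arg_cong[where f = "(**) (of_columns A)"]) (simp add: vec_eq_iff D_left B'_def)
  define G where "G = B' ** N ** of_columns A"
  have "of_columns A ** (D \<gamma>\<^sub>0 ** B' ** N) = mat 1"
    using N by (simp add: mix matrix_mul_assoc)
  \<comment> \<open>A one-sided inverse of a square matrix is two-sided, which moves
    \<open>of_columns A\<close> to the right end.\<close>
  then have "D \<gamma>\<^sub>0 ** B' ** N ** of_columns A = mat 1"
    by (simp add: matrix_left_right_inverse)
  then have G1: "D \<gamma>\<^sub>0 ** G = mat 1" by (simp add: G_def matrix_mul_assoc)
  have G0: "G $ p $ q = 0" if "p \<noteq> q" for p q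
  proof -
    have "scalar_product (C p) \<gamma>\<^sub>0 * G $ p $ p' = (if p = p' then 1 else 0)" for p'
      using G1 by (simp add: D_left[symmetric] mat_def)
    from this[of p] this[of q] that show ?thesis by auto
  qed
  have "(D \<gamma> ** G ** D \<gamma>') $ p $ q = (D \<gamma>' ** G ** D \<gamma>) $ p $ q" for p q
    by (cases "p = q") (simp_all add: D_right D_left G0)
  then have "D \<gamma> ** G ** D \<gamma>' = D \<gamma>' ** G ** D \<gamma>" by (simp add: vec_eq_iff)
  moreover have "slice_mix X \<gamma> ** N ** slice_mix X \<gamma>' = of_columns A ** (D \<gamma> ** G ** D \<gamma>') ** B'" for \<gamma> \<gamma>'
    by (simp add: mix G_def matrix_mul_assoc)
  ultimately show ?thesis by simp
qed

text \<open>Commutation is a closed condition and forces all mixed slices to be diagonal with respect to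
  the eigenvectors of the one with distinct eigenvalues.\<close>

lemma krank_le_if_slice_mix_commute:
  fixes X :: "('a::field,'r::finite,'r,'k::finite) tensor"
  assumes sp: "simple_spectrum X \<gamma>\<^sub>0 \<gamma>\<^sub>1 \<mu> v" and N: "slice_mix X \<gamma>\<^sub>0 ** N = mat 1"
    and comm: "\<And>\<gamma>. slice_mix X \<gamma> ** N ** slice_mix X \<gamma>\<^sub>1 = slice_mix X \<gamma>\<^sub>1 ** N ** slice_mix X \<gamma>"
  shows "krank X \<le> CARD('r)"
proof -
  let ?M = "slice_mix X"
  have N': "N ** ?M \<gamma>\<^sub>0 = mat 1" using N by (simp add: matrix_left_right_inverse)
  have inj: "inj \<mu>" and eig: "\<And>q. ?M \<gamma>\<^sub>1 *v v q = \<mu> q *s (?M \<gamma>\<^sub>0 *v v q)"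
    using sp by (auto simp: simple_spectrum_def)
  have eigN: "N *v (?M \<gamma>\<^sub>1 *v v q) = \<mu> q *s v q" for q
    by (simp add: eig matrix_vector_mult_scale matrix_vector_mul_assoc N')
  have invV: "invertible (of_columns v)" by (rule simple_spectrum_basis[OF sp])
  have "\<exists>c. ?M \<gamma> *v v q = c *s (?M \<gamma>\<^sub>0 *v v q)" for \<gamma> q
  proof -
    \<comment> \<open>By commutation \<open>w\<close> satisfies the eigenvalue equation of
      \<open>v q\<close>; as the eigenvalues are distinct, its expansion in the eigenbasis reduces
      to a multiple of \<open>v q\<close>.\<close>
    define w where "w = N *v (?M \<gamma> *v v q)"
    have "N *v (?M \<gamma>\<^sub>1 *v w) = N *v ((?M \<gamma>\<^sub>1 ** N ** ?M \<gamma>) *v v q)"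
      by (simp add: w_def matrix_vector_mul_assoc matrix_mul_assoc)
    also have "\<dots> = N *v (?M \<gamma> *v (N *v (?M \<gamma>\<^sub>1 *v v q)))"
      by (simp add: comm[symmetric] matrix_vector_mul_assoc matrix_mul_assoc)
    also have "\<dots> = \<mu> q *s w" by (simp add: eigN matrix_vector_mult_scale w_def)
    finally have w: "N *v (?M \<gamma>\<^sub>1 *v w) = \<mu> q *s w" .
    obtain \<xi> where \<xi>: "of_columns v *v \<xi> = w" using invertible_surj[OF invV] by blast
    have "of_columns v *v (\<chi> p. \<mu> p * \<xi> $ p) = (\<Sum>p\<in>UNIV. \<xi> $ p *s (N *v (?M \<gamma>\<^sub>1 *v v p)))"
      by (simp add: of_columns_mult eigN mult.commute)
    also have "\<dots> = N *v (?M \<gamma>\<^sub>1 *v w)"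
      by (simp add: \<xi>[symmetric] of_columns_mult vec.linear_sum[OF matrix_vector_mul_linear_gen] matrix_vector_mult_scale)
    also have "\<dots> = of_columns v *v (\<mu> q *s \<xi>)" by (simp add: w matrix_vector_mult_scale \<xi>)
    finally have "(\<chi> p. \<mu> p * \<xi> $ p) = \<mu> q *s \<xi>" by (rule invertible_inj[OF invV])
    then have "\<xi> $ p = 0" if "p \<noteq> q" for p
      using that inj by (auto simp: vec_eq_iff dest: injD)
    then have "w = (\<Sum>p\<in>{q}. \<xi> $ p *s v p)"
      unfolding \<xi>[symmetric] of_columns_mult by (intro sum.mono_neutral_right) auto
    then have "?M \<gamma>\<^sub>0 *v w = \<xi> $ q *s (?M \<gamma>\<^sub>0 *v v q)" by (simp add: matrix_vector_mult_scale)
    moreover have "?M \<gamma>\<^sub>0 *v w = ?M \<gamma> *v v q" by (simp add: w_def matrix_vector_mul_assoc matrix_mul_assoc N)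
    ultimately show ?thesis by auto
  qed
  then obtain c where c: "\<And>\<gamma> q. ?M \<gamma> *v v q = c \<gamma> q *s (?M \<gamma>\<^sub>0 *v v q)" by metis
  obtain W where W: "of_columns v ** W = mat 1" using invV by (auto simp: invertible_right_inverse)
  \<comment> \<open>The factors come from the eigenbasis: its image under the invertible mix, its
    dual basis (the rows of \<open>W\<close>), and the scalars by which the single slices
    act.\<close>
  have "X = (\<Sum>q\<in>UNIV. outer3 (?M \<gamma>\<^sub>0 *v v q) (W $ q) (\<chi> k. c (axis k 1) q))"
  proof -
    have "X $ a $ b $ k = (\<Sum>q\<in>UNIV. (?M \<gamma>\<^sub>0 *v v q) $ a * W $ q $ b * c (axis k 1) q)" for a b k
    proof -
      have "X $ a $ b $ k = (?M (axis k 1) ** of_columns v ** W) $ a $ b"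
        by (simp add: matrix_mul_assoc[symmetric] W slice_mix_axis)
      also have "\<dots> = (\<Sum>q\<in>UNIV. (?M (axis k 1) *v v q) $ a * W $ q $ b)"
        by (simp add: matrix_matrix_mult_def matrix_vector_mult_def of_columns_def)
      finally show ?thesis by (simp add: c[of "axis k 1"] mult_ac)
    qed
    then show ?thesis by (simp add: vec_eq_iff outer3_def)
  qed
  from krank_le_if_sum[OF _ this] show ?thesis by simp
qed

lemma tendsto_det:
  fixes M :: "'b \<Rightarrow> 'a::real_normed_field^'n::finite^'n"
  assumes "(M \<longlongrightarrow> L) F"
  shows "((\<lambda>n. det (M n)) \<longlongrightarrow> det L) F"
  unfolding det_def by (intro tendsto_sum tendsto_mult tendsto_prod tendsto_const tendsto_vec_nth assms)

lemma tendsto_matrix_mult: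
  fixes M N :: "'b \<Rightarrow> 'a::real_normed_field^'n::finite^'n"
  assumes "(M \<longlongrightarrow> L) F" "(N \<longlongrightarrow> K) F"
  shows "((\<lambda>n. M n ** N n) \<longlongrightarrow> L ** K) F"
proof -
  have "((\<lambda>n. (M n ** N n) $ i $ j) \<longlongrightarrow> (L ** K) $ i $ j) F" for i j
    unfolding matrix_matrix_mult_def vec_lambda_beta
    by (intro tendsto_sum tendsto_mult tendsto_vec_nth assms)
  then show ?thesis by (intro vec_tendstoI)
qed

text \<open>Cramer's rule gives the entries as quotients of determinants, so continuity at
  invertible matrices can be read off.\<close>

definition cramer_inverse :: "'a::field^'n::finite^'n \<Rightarrow> 'a^'n^'n" where
  "cramer_inverse M = (\<chi> k l. det (\<chi> i j. if j = k then axis l 1 $ i else M $ i $ j) / det M)"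

lemma cramer_inverse:
  assumes "det M \<noteq> 0"
  shows "M ** cramer_inverse M = mat 1"
proof -
  have "(M ** cramer_inverse M) $ a $ l = mat 1 $ a $ l" for a l
  proof -
    have "M *v (\<chi> k. cramer_inverse M $ k $ l) = axis l 1"
      using cramer[OF assms] by (simp add: cramer_inverse_def)
    then have "(M *v (\<chi> k. cramer_inverse M $ k $ l)) $ a = axis l 1 $ a" by simp
    then show ?thesis by (simp add: matrix_vector_mult_def matrix_matrix_mult_def mat_def axis_def)
  qed
  then show ?thesis by (simp add: vec_eq_iff)
qed

lemma tendsto_cramer_inverse:
  fixes M :: "'b \<Rightarrow> 'a::real_normed_field^'n::finite^'n"
  assumes "(M \<longlongrightarrow> L) F" "det L \<noteq> 0"
  shows "((\<lambda>n. cramer_inverse (M n)) \<longlongrightarrow> cramer_inverse L) F"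
proof -
  have "((\<lambda>n. (\<chi> i j. if j = k then axis l 1 $ i else M n $ i $ j) $ a $ b)
      \<longlongrightarrow> (\<chi> i j. if j = k then axis l 1 $ i else L $ i $ j) $ a $ b) F" for k l a b :: 'n
    using assms(1) by (cases "b = k") (simp_all add: tendsto_vec_nth)
  then have "((\<lambda>n. \<chi> i j. if j = k then axis l 1 $ i else M n $ i $ j)
      \<longlongrightarrow> (\<chi> i j. if j = k then axis l 1 $ i else L $ i $ j)) F" for k l :: 'n
    by (intro vec_tendstoI)
  then have "((\<lambda>n. cramer_inverse (M n) $ k $ l) \<longlongrightarrow> cramer_inverse L $ k $ l) F" for k l
    unfolding cramer_inverse_def vec_lambda_beta by (intro tendsto_divide tendsto_det assms)
  then show ?thesis by (intro vec_tendstoI)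
qed

lemma tendsto_slice_mix:
  fixes X :: "'b \<Rightarrow> ('a::real_normed_field,'r::finite,'r,'k::finite) tensor"
  assumes "(X \<longlongrightarrow> Y) F"
  shows "((\<lambda>n. slice_mix (X n) \<gamma>) \<longlongrightarrow> slice_mix Y \<gamma>) F"
proof -
  have "((\<lambda>n. slice_mix (X n) \<gamma> $ i $ j) \<longlongrightarrow> slice_mix Y \<gamma> $ i $ j) F" for i j
    unfolding slice_mix_nth by (intro tendsto_sum tendsto_mult tendsto_const tendsto_vec_nth assms)
  then show ?thesis by (intro vec_tendstoI)
qed

text \<open>The commutation relations of the approximating tensors survive in the limit, where the
  simple spectrum of \<open>X\<close> turns them back into a decomposition.\<close>

lemma krank_le_limit:
  fixes X :: "('a::real_normed_field,'r::finite,'r,'k::finite) tensor"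
  assumes sp: "simple_spectrum X \<gamma>\<^sub>0 \<gamma>\<^sub>1 \<mu> v" and clos: "X \<in> closure {Y. krank Y \<le> CARD('r)}"
  shows "krank X \<le> CARD('r)"
proof -
  obtain Y where Y: "\<And>n. krank (Y n) \<le> CARD('r)" and lim: "Y \<longlonglongrightarrow> X"
    using clos by (auto simp: closure_sequential)
  let ?N = "\<lambda>Z. cramer_inverse (slice_mix Z \<gamma>\<^sub>0)"
  have det: "det (slice_mix X \<gamma>\<^sub>0) \<noteq> 0"
    using sp by (simp add: simple_spectrum_def invertible_det_nz)
  have limM: "(\<lambda>n. slice_mix (Y n) \<gamma>) \<longlonglongrightarrow> slice_mix X \<gamma>" for \<gamma>
    by (rule tendsto_slice_mix[OF lim])
  have limN: "(\<lambda>n. ?N (Y n)) \<longlonglongrightarrow> ?N X"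
    by (rule tendsto_cramer_inverse[OF limM det])
  \<comment> \<open>Commutation is available only for approximants with invertible mix at
    \<open>\<gamma>\<^sub>0\<close>, which holds from some index on.\<close>
  have ev: "\<forall>\<^sub>F n in sequentially. det (slice_mix (Y n) \<gamma>\<^sub>0) \<noteq> 0"
    by (rule tendsto_imp_eventually_ne[OF tendsto_det[OF limM] det])
  have "slice_mix X \<gamma> ** ?N X ** slice_mix X \<gamma>\<^sub>1 = slice_mix X \<gamma>\<^sub>1 ** ?N X ** slice_mix X \<gamma>" for \<gamma>
  proof (rule tendsto_unique)
    show "(\<lambda>n. slice_mix (Y n) \<gamma> ** ?N (Y n) ** slice_mix (Y n) \<gamma>\<^sub>1) \<longlonglongrightarrow> slice_mix X \<gamma> ** ?N X ** slice_mix X \<gamma>\<^sub>1"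
      by (intro tendsto_matrix_mult limM limN)
    have "(\<lambda>n. slice_mix (Y n) \<gamma>\<^sub>1 ** ?N (Y n) ** slice_mix (Y n) \<gamma>) \<longlonglongrightarrow> slice_mix X \<gamma>\<^sub>1 ** ?N X ** slice_mix X \<gamma>"
      by (intro tendsto_matrix_mult limM limN)
    then show "(\<lambda>n. slice_mix (Y n) \<gamma> ** ?N (Y n) ** slice_mix (Y n) \<gamma>\<^sub>1) \<longlonglongrightarrow> slice_mix X \<gamma>\<^sub>1 ** ?N X ** slice_mix X \<gamma>"
      by (rule Lim_transform_eventually)
        (use ev in \<open>eventually_elim, simp add: slice_mix_commute[OF Y cramer_inverse]\<close>)
  qed simp
  then show ?thesis
    using krank_le_if_slice_mix_commute[OF sp cramer_inverse[OF det]] by blast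
qed

section \<open>Best approximations near the compressed tensor\<close>

theorem theorem2p5:
  fixes T' :: "('a::{real_normed_field,euclidean_space},'i1::finite,'i2::finite,'i3::finite) tensor"
    and T :: "('a,'r::finite,'r,'k::finite) tensor"
    and V1 :: "'a^'r^'i1" and V2 :: "'a^'r^'i2" and V3 :: "'a^'k^'i3"
    and U :: "'a^'k^'k"
    and e :: "nat \<Rightarrow> 'k"
    and eps :: "nat \<Rightarrow> real"
  assumes rank: "krank T' = CARD('r)"
    and mlrank: "mlrank T' = (CARD('r), CARD('r), CARD('k))"
    and compr: "orth_compression T' V1 V2 V3 T"
    and unit: "unitary U"
    and enum: "bij_betw e {1..CARD('k)} UNIV"
    and eps_nonneg: "\<forall>i\<in>{1..CARD('k) div 2}. eps i \<ge> 0"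
    and eps_simple: "\<forall>i\<in>{1..CARD('k) div 2}. \<forall>P \<in> ball (pencil (mode3_mult T U) e i) (eps i).
                        simple_tensor P"
  shows "(\<forall>X \<in> ball T (sqrt (\<Sum>i=1..CARD('k) div 2. (eps i)^2) / 2).
            \<exists>Y. best_rank_approx CARD('r) X Y)
       \<and> (\<forall>X \<in> ball T (sqrt (\<Sum>i=1..CARD('k) div 2. (eps i)^2)).
            krank X = CARD('r) \<longrightarrow> unique_CPD X)
       \<and> negligible {X \<in> ball T (sqrt (\<Sum>i=1..CARD('k) div 2. (eps i)^2) / 2).
            \<not> (\<exists>!Y. best_rank_approx CARD('r) X Y)}"
proof -
  define r where "r = sqrt (\<Sum>i=1..CARD('k) div 2. (eps i)^2)"
  \<comment> \<open>Tensors of bounded rank need not form a closed set, so distances are first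
    minimised over the closure.\<close>
  define C :: "('a,'r,'r,'k) tensor set" where "C = closure {Y. krank Y \<le> CARD('r)}"
  have closedC: "closed C" by (simp add: C_def)
  have subC: "{Y. krank Y \<le> CARD('r)} \<subseteq> C" by (simp add: C_def closure_subset)
  have spectrum: "\<exists>\<gamma>\<^sub>0 \<gamma>\<^sub>1 \<mu> v. simple_spectrum X \<gamma>\<^sub>0 \<gamma>\<^sub>1 \<mu> v" if "X \<in> ball T r" for X
    using simple_pencil_in_ball[OF unit enum eps_nonneg eps_simple, of X] that
      simple_spectrum_if_simple_pencil unfolding r_def by blast
  have "krank T \<le> krank T'"
    using compr by (intro mode_products_krank_le[where F = "\<lambda>a i. kconj (V1$i$a)"
      and G = "\<lambda>b j. kconj (V2$j$b)" and H = "\<lambda>c k. kconj (V3$k$c)"]) (simp add: orth_compression_def)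
  then have TC: "T \<in> C" using rank subC by auto
  have exists: "\<exists>Y. best_rank_approx CARD('r) X Y" if X: "X \<in> ball T (r / 2)" for X
  proof -
    obtain Y where Y: "Y \<in> C" "\<And>Z. Z \<in> C \<Longrightarrow> dist X Y \<le> dist X Z"
      using distance_attains_inf[OF closedC, of X] TC by (metis empty_iff)
    \<comment> \<open>\<open>T\<close> itself competes in \<open>C\<close>, so \<open>Y\<close> is
      no farther from \<open>X\<close> than \<open>T\<close> is. Both distances are below
      \<open>r / 2\<close>, which explains the halved radius.\<close>
    have "dist T Y \<le> dist T X + dist X Y" by (rule dist_triangle)
    also have "\<dots> < r" using X Y(2)[OF TC] by (simp add: dist_commute)
    finally have "Y \<in> ball T r" by simp
    then have "krank Y \<le> CARD('r)"
      using spectrum krank_le_limit Y(1) unfolding C_def by blast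
    moreover have "dist X Y \<le> dist X Z" if "krank Z \<le> CARD('r)" for Z
      using Y(2)[of Z] that subC by blast
    ultimately show ?thesis by (auto simp: best_rank_approx_def)
  qed
  \<comment> \<open>By continuity of the distance, a minimiser over tensors of bounded rank also
    minimises over their closure.\<close>
  have nearest: "Y \<in> nearest_points C X" if "best_rank_approx CARD('r) X Y" for X Y
  proof -
    have "closure {Y. krank Y \<le> CARD('r)} \<subseteq> {Z. dist X Y \<le> dist X Z}"
      using that by (intro closure_minimal closed_Collect_le continuous_intros)
        (auto simp: best_rank_approx_def)
    then show ?thesis
      using that subC by (auto simp: nearest_points_def best_rank_approx_def C_def[symmetric])
  qed
  have "negligible {X \<in> ball T (r / 2). \<not> (\<exists>!Y. best_rank_approx CARD('r) X Y)}"
  proof (rule negligible_subset[OF negligible_nonunique_nearest[of C]])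
    show "closed C" by (rule closedC)
    \<comment> \<open>Since a best approximation exists, failing uniqueness yields two different
      ones, and both are nearest points.\<close>
    show "{X \<in> ball T (r / 2). \<not> (\<exists>!Y. best_rank_approx CARD('r) X Y)}
      \<subseteq> {x. \<exists>c\<in>nearest_points C x. \<exists>d\<in>nearest_points C x. c \<noteq> d}"
      using exists nearest by blast
  qed
  moreover have "unique_CPD X" if "X \<in> ball T r" "krank X = CARD('r)" for X
    using spectrum[OF that(1)] unique_CPD_if_simple_spectrum that(2) by blast
  ultimately show ?thesis using exists unfolding r_def by blast
qed

end
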